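(* Let $G^{C_4}$ be a $4$-chromatic semi-maximal planar graph with outer cycle $C_4=v_1v_2v_3v_4v_1$, and suppose $F_2(G^{C_4})\neq\emptyset$. Then for every $f\in F_2(G^{C_4})$, with colours named so that $f(v_1)=f(v_3)=1$ and $f(v_2)=f(v_4)=2$, exactly two of the four sets $P_{13}^{f}(v_1,v_3)$, $P_{14}^{f}(v_1,v_3)$, $P_{23}^{f}(v_2,v_4)$, $P_{24}^{f}(v_2,v_4)$ are nonempty.
   Context: A semi-maximal planar graph (SMPG) $G^{C}$ with respect to a cycle $C$ is a plane graph whose outer face is bounded by the cycle $C$ of length at least $4$ and all of whose other faces are triangles. Colours are $\{1,2,3,4\}$; $C_4^0(G^{C_4})$ is the set of proper $4$-colourings up to permutation of colour names, and $F_2(G^{C_4})$ is the set of $f\in C_4^0(G^{C_4})$ with $|\{f(v_1),f(v_2),f(v_3),f(v_4)\}|=2$. For $i\in\{3,4\}$, $P_{1i}^f(v_1,v_3)$ is the set of paths in $G^{C_4}$ from $v_1$ to $v_3$ all of whose vertices have colour $1$ or $i$ under $f$, and $P_{2i}^f(v_2,v_4)$ is the set of paths from $v_2$ to $v_4$ all of whose vertices have colour $2$ or $i$. *)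

theory Defs
  imports "HOL-Analysis.Analysis" "HOL-Combinatorics.Permutations"
begin

text \<open>A finite simple graph is given by a vertex set \<open>V\<close> and a set \<open>E\<close> of two-element
  subsets of \<open>V\<close>. Its colourings are extensional functions, so that two colourings are equal
  iff they agree on \<open>V\<close>.\<close>

definition colourings :: "'v set \<Rightarrow> 'v set set \<Rightarrow> nat \<Rightarrow> ('v \<Rightarrow> nat) set" where
  "colourings V E k = {f \<in> V \<rightarrow>\<^sub>E {1..k}. \<forall>u v. {u, v} \<in> E \<longrightarrow> f u \<noteq> f v}"

definition chromatic_number :: "'v set \<Rightarrow> 'v set set \<Rightarrow> nat" where
  "chromatic_number V E = (LEAST k. colourings V E k \<noteq> {})"

definition colour_renaming :: "'v set \<Rightarrow> 'v set set \<Rightarrow> (('v \<Rightarrow> nat) \<times> ('v \<Rightarrow> nat)) set" where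
  "colour_renaming V E =
     {(f, g). f \<in> colourings V E 4 \<and> g \<in> colourings V E 4 \<and>
              (\<exists>\<sigma>. \<sigma> permutes {1..4} \<and> (\<forall>x\<in>V. g x = \<sigma> (f x)))}"

definition C40 :: "'v set \<Rightarrow> 'v set set \<Rightarrow> ('v \<Rightarrow> nat) set set" where
  "C40 V E = colourings V E 4 // colour_renaming V E"

text \<open>The number of colours on \<open>S\<close> is the same for all members of a class.\<close>

definition F2 :: "'v set \<Rightarrow> 'v set set \<Rightarrow> 'v set \<Rightarrow> ('v \<Rightarrow> nat) set set" where
  "F2 V E S = {c \<in> C40 V E. \<forall>f\<in>c. card (f ` S) = 2}"

definition paths :: "'v set \<Rightarrow> 'v set set \<Rightarrow> 'v \<Rightarrow> 'v \<Rightarrow> 'v list set" where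
  "paths V E u w = {p. p \<noteq> [] \<and> hd p = u \<and> last p = w \<and> distinct p \<and> set p \<subseteq> V \<and>
                       successively (\<lambda>x y. {x, y} \<in> E) p}"

definition bicoloured_paths ::
  "'v set \<Rightarrow> 'v set set \<Rightarrow> ('v \<Rightarrow> nat) \<Rightarrow> nat \<Rightarrow> nat \<Rightarrow> 'v \<Rightarrow> 'v \<Rightarrow> 'v list set" where
  "bicoloured_paths V E f i j u w = {p \<in> paths V E u w. f ` set p \<subseteq> {i, j}}"

definition cycle_edges :: "'v list \<Rightarrow> 'v set set" where
  "cycle_edges vs = {{vs ! i, vs ! (Suc i mod length vs)} |i. i < length vs}"

definition is_cycle :: "'v set \<Rightarrow> 'v set set \<Rightarrow> 'v list \<Rightarrow> bool" where
  "is_cycle V E vs \<longleftrightarrow>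
     3 \<le> length vs \<and> distinct vs \<and> set vs \<subseteq> V \<and> cycle_edges vs \<subseteq> E"

text \<open>A plane graph has points of the plane as vertices; the edge \<open>e = {u, v}\<close> is drawn as the
  arc \<open>\<gamma> e\<close> with end points \<open>u\<close> and \<open>v\<close>. An arc meets the vertex set in its two ends only, and
  two different arcs meet at most in common ends. In particular every edge has two distinct
  ends.\<close>

definition plane_graph ::
  "complex set \<Rightarrow> complex set set \<Rightarrow> (complex set \<Rightarrow> real \<Rightarrow> complex) \<Rightarrow> bool" where
  "plane_graph V E \<gamma> \<longleftrightarrow>
     finite V \<and>
     (\<forall>e\<in>E. arc (\<gamma> e) \<and> {pathstart (\<gamma> e), pathfinish (\<gamma> e)} = e \<and>
            path_image (\<gamma> e) \<inter> V = e) \<and>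
     (\<forall>e\<in>E. \<forall>e'\<in>E. e \<noteq> e' \<longrightarrow> path_image (\<gamma> e) \<inter> path_image (\<gamma> e') = e \<inter> e')"

definition drawn_edges :: "(complex set \<Rightarrow> real \<Rightarrow> complex) \<Rightarrow> complex set set \<Rightarrow> complex set" where
  "drawn_edges \<gamma> E = (\<Union>e\<in>E. path_image (\<gamma> e))"

definition faces ::
  "complex set \<Rightarrow> complex set set \<Rightarrow> (complex set \<Rightarrow> real \<Rightarrow> complex) \<Rightarrow> complex set set" where
  "faces V E \<gamma> = components (- (V \<union> drawn_edges \<gamma> E))"

definition face_bounded_by ::
  "(complex set \<Rightarrow> real \<Rightarrow> complex) \<Rightarrow> complex set \<Rightarrow> complex list \<Rightarrow> bool" where
  "face_bounded_by \<gamma> F vs \<longleftrightarrow> frontier F = drawn_edges \<gamma> (cycle_edges vs)"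

text \<open>A plane graph is a compact subset of the plane, so exactly one of its faces is unbounded:
  the outer face.\<close>

definition semi_maximal_planar_graph ::
  "complex set \<Rightarrow> complex set set \<Rightarrow> (complex set \<Rightarrow> real \<Rightarrow> complex) \<Rightarrow> complex list \<Rightarrow> bool" where
  "semi_maximal_planar_graph V E \<gamma> C \<longleftrightarrow>
     plane_graph V E \<gamma> \<and> is_cycle V E C \<and> 4 \<le> length C \<and>
     (\<forall>F\<in>faces V E \<gamma>. \<not> bounded F \<longrightarrow> face_bounded_by \<gamma> F C) \<and>
     (\<forall>F\<in>faces V E \<gamma>. bounded F \<longrightarrow>
        (\<exists>T. is_cycle V E T \<and> length T = 3 \<and> face_bounded_by \<gamma> F T))"

lemma equiv_colour_renaming: "equiv (colourings V E 4) (colour_renaming V E)"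
proof (rule equivI)
  show "colour_renaming V E \<subseteq> colourings V E 4 \<times> colourings V E 4"
    by (auto simp: colour_renaming_def)
  show "refl_on (colourings V E 4) (colour_renaming V E)"
    unfolding refl_on_def colour_renaming_def using permutes_id by fastforce
  show "sym (colour_renaming V E)"
  proof (rule symI)
    fix f g assume "(f, g) \<in> colour_renaming V E"
    then obtain \<sigma> where s: "f \<in> colourings V E 4" "g \<in> colourings V E 4"
      "\<sigma> permutes {1..4}" "\<forall>x\<in>V. g x = \<sigma> (f x)"
      by (auto simp: colour_renaming_def)
    then have "inv \<sigma> permutes {1..4}" "\<forall>x\<in>V. f x = inv \<sigma> (g x)"
      by (auto simp: permutes_inv permutes_inverses)
    with s show "(g, f) \<in> colour_renaming V E" by (auto simp: colour_renaming_def)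
  qed
  show "trans (colour_renaming V E)"
  proof (rule transI)
    fix f g h assume "(f, g) \<in> colour_renaming V E" "(g, h) \<in> colour_renaming V E"
    then obtain \<sigma> \<tau> where s: "f \<in> colourings V E 4" "h \<in> colourings V E 4"
      "\<sigma> permutes {1..4}" "\<tau> permutes {1..4}"
      "\<forall>x\<in>V. g x = \<sigma> (f x)" "\<forall>x\<in>V. h x = \<tau> (g x)"
      by (auto simp: colour_renaming_def)
    then have "(\<tau> \<circ> \<sigma>) permutes {1..4}" "\<forall>x\<in>V. h x = (\<tau> \<circ> \<sigma>) (f x)"
      by (auto intro: permutes_compose)
    with s show "(f, h) \<in> colour_renaming V E" unfolding colour_renaming_def by blast
  qed
qed

text \<open>The colours of a class in \<open>F2\<close> can be named so that the colours along the cycle are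
  1, 2, 1, 2; hence quantifying over such representatives is never vacuous.\<close>

lemma F2_named_representative:
  assumes EV: "\<Union>E \<subseteq> V"
    and cyc: "is_cycle V E [v1, v2, v3, v4]"
    and c: "c \<in> F2 V E {v1, v2, v3, v4}"
  shows "\<exists>f\<in>c. f v1 = 1 \<and> f v3 = 1 \<and> f v2 = 2 \<and> f v4 = 2"
proof -
  have V: "v1 \<in> V" "v2 \<in> V" "v3 \<in> V" "v4 \<in> V" using cyc by (auto simp: is_cycle_def)
  have edge: "{[v1, v2, v3, v4] ! i, [v1, v2, v3, v4] ! (Suc i mod 4)} \<in> E" if "i < 4" for i
  proof -
    have "{[v1, v2, v3, v4] ! i, [v1, v2, v3, v4] ! (Suc i mod 4)} \<in> cycle_edges [v1, v2, v3, v4]"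
      unfolding cycle_edges_def mem_Collect_eq using that by (intro exI[of _ i]) simp
    then show ?thesis using cyc unfolding is_cycle_def by blast
  qed
  have E: "{v1, v2} \<in> E" "{v2, v3} \<in> E" "{v3, v4} \<in> E" "{v4, v1} \<in> E"
    using edge[of 0] edge[of 1] edge[of 2] edge[of 3] by simp_all
  obtain f where f: "f \<in> colourings V E 4" "c = colour_renaming V E `` {f}"
    using c by (auto simp: F2_def C40_def elim: quotientE)
  have fc: "f \<in> c"
    using f equiv_class_self[OF equiv_colour_renaming] by metis
  have two: "card {f v1, f v2, f v3, f v4} = 2"
    using c fc by (simp add: F2_def)
  have ne: "f v1 \<noteq> f v2" "f v2 \<noteq> f v3" "f v3 \<noteq> f v4" "f v4 \<noteq> f v1"
    using f(1) E unfolding colourings_def by blast+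
  have eq: "f v3 = f v1" "f v4 = f v2"
    using two ne by (simp_all add: card_insert_if split: if_splits)
  have rng: "f x \<in> {1..4}" if "x \<in> V" for x
    using f(1) that by (auto simp: colourings_def)
  obtain \<sigma> where s: "\<sigma> permutes {1..4}" "\<sigma> (f v1) = 1" "\<sigma> (f v2) = 2"
  proof
    let ?a = "Transposition.transpose (f v1) (1::nat)"
    let ?b = "Transposition.transpose (?a (f v2)) (2::nat)"
    have a: "?a permutes {1..4}" using rng V by (intro permutes_swap_id) auto
    have "?a (f v2) \<in> {1..4}" using a rng V permutes_in_image by metis
    then have "?b permutes {1..4}" by (intro permutes_swap_id) auto
    with a show "(?b \<circ> ?a) permutes {1..4}" by (rule permutes_compose)
    have "?a (f v2) \<noteq> 1" using ne(1) by (auto simp: Transposition.transpose_def)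
    then show "(?b \<circ> ?a) (f v1) = 1" by (auto simp: Transposition.transpose_def)
    show "(?b \<circ> ?a) (f v2) = 2" by simp
  qed
  define g where "g = restrict (\<sigma> \<circ> f) V"
  have "g \<in> colourings V E 4"
  proof -
    have "g \<in> V \<rightarrow>\<^sub>E {1..4}"
      unfolding g_def restrict_PiE_iff using permutes_in_image[OF s(1)] rng by auto
    moreover have "g u \<noteq> g v" if e: "{u, v} \<in> E" for u v
    proof -
      have "u \<in> V" "v \<in> V" using e EV by auto
      moreover have "f u \<noteq> f v" using f(1) e by (auto simp: colourings_def)
      ultimately show ?thesis
        using permutes_inj[OF s(1)] by (auto simp: g_def dest: injD)
    qed
    ultimately show ?thesis by (auto simp: colourings_def)
  qed
  then have "(f, g) \<in> colour_renaming V E"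
    using f s by (auto simp: colour_renaming_def g_def)
  then have "g \<in> c" using f(2) by blast
  moreover have "g v1 = 1 \<and> g v3 = 1 \<and> g v2 = 2 \<and> g v4 = 2"
    using V s eq by (simp add: g_def)
  ultimately show ?thesis by blast
qed

end

(* Each face is one side of the Jordan curve that bounds it. Near an inner point x of an edge e
   on a facial cycle J, the set J and the rest of the drawing (without the interior of e) meet in the arc J - e,
   so by Janiszewski's theorem all points near x on the other side of J lie in one face: every edge
   lies on exactly two faces. Hence a set of edges that has an even number of edges on every triangle
   has an even number of edges on C.

   Apply this to the edges joining X, the vertices reachable from v1 in colours 1, 3, to Y, those
   reachable from v2 in colours 2, 4. A triangle contains 0 or 2 of them, and v1 v2 is one, so there is
   another one on C, which puts v3 in X or v4 in Y. Not both, since paths from v1 to v3 and from v2 to v4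
   in the disc cross. The same holds for the colour classes 1, 4 and 2, 3. *)

theory Submission imports Defs begin

section \<open>Drawn paths and cycles\<close>

definition path_edges :: "'v list \<Rightarrow> 'v set set" where
  "path_edges p = {{p ! i, p ! Suc i} |i. Suc i < length p}"

lemma path_edges_simps [simp]:
  "path_edges [] = {}" "path_edges [u] = {}"
  "path_edges (u # v # p) = insert {u, v} (path_edges (v # p))"
proof -
  have "{{(u # v # p) ! i, (u # v # p) ! Suc i} |i. Suc i < length (u # v # p)} =
        insert {u, v} {{(v # p) ! i, (v # p) ! Suc i} |i. Suc i < length (v # p)}" (is "?L = ?R")
  proof
    show "?L \<subseteq> ?R"
    proof
      fix e assume "e \<in> ?L"
      then obtain i where i: "e = {(u # v # p) ! i, (u # v # p) ! Suc i}" "Suc i < length (u # v # p)"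
        by blast
      show "e \<in> ?R" using i by (cases i) auto
    qed
    show "?R \<subseteq> ?L"
    proof
      fix e assume "e \<in> ?R"
      then consider "e = {u, v}" | i where "e = {(v # p) ! i, (v # p) ! Suc i}" "Suc i < length (v # p)"
        by blast
      then show "e \<in> ?L"
      proof cases
        case 1 then show ?thesis by (force intro!: exI[of _ 0])
      next
        case (2 i) then show ?thesis by (force intro!: exI[of _ "Suc i"])
      qed
    qed
  qed
  then show "path_edges (u # v # p) = insert {u, v} (path_edges (v # p))"
    by (simp add: path_edges_def)
qed (auto simp: path_edges_def)

lemma path_edges_subset: "e \<in> path_edges p \<Longrightarrow> e \<subseteq> set p"
  by (auto simp: path_edges_def)

lemma Union_path_edges: "2 \<le> length p \<Longrightarrow> \<Union>(path_edges p) = set p"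
proof (induction p)
  case (Cons u q)
  then show ?case
  proof (cases q)
    case q: (Cons v r)
    then show ?thesis using Cons by (cases r) auto
  qed simp
qed simp

lemma successively_path_edges: "successively (\<lambda>x y. {x, y} \<in> E) p \<longleftrightarrow> path_edges p \<subseteq> E"
  by (auto simp: successively_conv_nth path_edges_def)

lemma cycle_edges_eq_insert:
  assumes "vs \<noteq> []"
  shows "cycle_edges vs = insert {last vs, hd vs} (path_edges vs)"
proof -
  have "cycle_edges vs = (\<lambda>i. {vs ! i, vs ! (Suc i mod length vs)}) ` {..<length vs}"
    by (auto simp: cycle_edges_def)
  \<comment> \<open>The last index is the only one whose successor wraps around; it yields the
    closing edge \<open>{last vs, hd vs}\<close>.\<close>
  also have "{..<length vs} = insert (length vs - 1) {i. Suc i < length vs}"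
    using assms by (cases vs) auto
  also have "(\<lambda>i. {vs ! i, vs ! (Suc i mod length vs)}) ` \<dots> =
    insert {last vs, hd vs} ((\<lambda>i. {vs ! i, vs ! (Suc i mod length vs)}) ` {i. Suc i < length vs})"
    using assms by (simp add: last_conv_nth hd_conv_nth)
  also have "(\<lambda>i. {vs ! i, vs ! (Suc i mod length vs)}) ` {i. Suc i < length vs} = path_edges vs"
    by (auto simp: path_edges_def)
  finally show ?thesis .
qed

lemma cycle_edges_rotate1: "cycle_edges (rotate1 vs) = cycle_edges vs"
proof (cases vs)
  case (Cons u p)
  have snoc: "path_edges (p @ [u]) = insert {last p, u} (path_edges p)" if "p \<noteq> []" for p :: "'a list"
    using that
  proof (induction p)
    case (Cons a p)
    then show ?case by (cases p) auto
  qed simp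
  show ?thesis
  proof (cases p)
    case (Cons v q)
    then have "cycle_edges (rotate1 vs) = insert {u, v} (insert {last p, u} (path_edges p))"
      using \<open>vs = u # p\<close> snoc[of p] by (simp add: cycle_edges_eq_insert)
    also have "\<dots> = cycle_edges vs"
      using \<open>vs = u # p\<close> Cons by (simp add: cycle_edges_eq_insert insert_commute)
    finally show ?thesis .
  qed (simp add: \<open>vs = u # p\<close>)
qed simp

lemma cycle_edges_rotate: "cycle_edges (rotate n vs) = cycle_edges vs"
  by (induction n) (simp_all add: cycle_edges_rotate1)

text \<open>Rotation leaves the edge set of a cycle unchanged and can turn any chosen edge into the
  closing one, so what is left after deleting that edge is the edge set of a path.\<close>

lemma cycle_edge_rotated_last:
  assumes "e \<in> cycle_edges vs"
  obtains ws where "set ws = set vs" "length ws = length vs" "distinct ws = distinct vs"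
    "cycle_edges ws = cycle_edges vs" "e = {last ws, hd ws}"
proof -
  obtain i where i: "i < length vs" "e = {vs ! i, vs ! (Suc i mod length vs)}"
    using assms by (auto simp: cycle_edges_def)
  then have ne: "vs \<noteq> []" by auto
  let ?ws = "rotate (Suc i) vs"
  have "hd ?ws = vs ! (Suc i mod length vs)"
    using hd_rotate_conv_nth[OF ne] .
  moreover have "last ?ws = vs ! i"
  proof -
    have "last ?ws = ?ws ! (length vs - 1)"
      using ne by (metis last_conv_nth length_rotate rotate_is_Nil_conv)
    also have "\<dots> = vs ! ((Suc i + (length vs - 1)) mod length vs)"
      using ne by (intro nth_rotate) (cases vs; simp)
    also have "Suc i + (length vs - 1) = i + length vs" using ne by (cases vs) auto
    finally show ?thesis using i by simp
  qed
  ultimately show thesis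
    using i by (intro that[of ?ws]) (simp_all only: set_rotate length_rotate distinct_rotate cycle_edges_rotate)
qed

lemma closing_edge_notin_path_edges:
  assumes "distinct vs" "3 \<le> length vs"
  shows "{last vs, hd vs} \<notin> path_edges vs"
proof
  assume "{last vs, hd vs} \<in> path_edges vs"
  then obtain i where i: "Suc i < length vs" "{last vs, hd vs} = {vs ! i, vs ! Suc i}"
    by (auto simp: path_edges_def)
  have inj: "vs ! j = vs ! k \<longleftrightarrow> j = k" if "j < length vs" "k < length vs" for j k
    using nth_eq_iff_index_eq[OF assms(1) that] .
  have "vs \<noteq> []" using assms by auto
  then have "{vs ! (length vs - 1), vs ! 0} = {vs ! i, vs ! Suc i}"
    using i(2) by (simp add: hd_conv_nth last_conv_nth)
  \<comment> \<open>First and last position would have to be consecutive, which happens only for a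
    list of length 2.\<close>
  then have "i = 0 \<and> Suc i = length vs - 1"
    using i(1) assms(2) inj[of "length vs - 1" i] inj[of "length vs - 1" "Suc i"]
      inj[of 0 i] inj[of 0 "Suc i"] unfolding doubleton_eq_iff by linarith
  then show False using assms by linarith
qed

section \<open>Drawn paths are arcs, drawn cycles are Jordan curves\<close>

locale plane =
  fixes V :: "complex set" and E :: "complex set set" and \<gamma> :: "complex set \<Rightarrow> real \<Rightarrow> complex"
  assumes plane_graph: "plane_graph V E \<gamma>"
begin

lemma finite_V: "finite V"
  and arc_edge: "e \<in> E \<Longrightarrow> arc (\<gamma> e)"
  and ends_edge: "e \<in> E \<Longrightarrow> {pathstart (\<gamma> e), pathfinish (\<gamma> e)} = e"
  and edge_Int_V: "e \<in> E \<Longrightarrow> path_image (\<gamma> e) \<inter> V = e"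
  and edge_Int_edge: "e \<in> E \<Longrightarrow> e' \<in> E \<Longrightarrow> e \<noteq> e' \<Longrightarrow> path_image (\<gamma> e) \<inter> path_image (\<gamma> e') = e \<inter> e'"
  using plane_graph by (auto simp: plane_graph_def)

lemma edge_subset_V: "e \<in> E \<Longrightarrow> e \<subseteq> V"
  using edge_Int_V by blast

lemma finite_E: "finite E"
  by (rule finite_subset[of _ "Pow V"]) (use edge_subset_V finite_V in auto)

lemma edge_distinct_ends: "{u, v} \<in> E \<Longrightarrow> u \<noteq> v"
  using arc_edge ends_edge arc_distinct_ends by (metis doubleton_eq_iff)

lemma compact_drawn_edges: "A \<subseteq> E \<Longrightarrow> compact (drawn_edges \<gamma> A)"
  unfolding drawn_edges_def using finite_E arc_edge
  by (intro compact_UN) (auto intro: finite_subset simp: arc_imp_path compact_path_image)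

text \<open>Different edges meet in common ends only. This reduces intersections of drawn sets to
  finite sets of vertices.\<close>

lemma drawn_edges_Int:
  assumes "A \<subseteq> E" "B \<subseteq> E" "A \<inter> B = {}"
  shows "drawn_edges \<gamma> A \<inter> drawn_edges \<gamma> B = \<Union>A \<inter> \<Union>B"
proof -
  have "path_image (\<gamma> a) \<inter> path_image (\<gamma> b) = a \<inter> b" if "a \<in> A" "b \<in> B" for a b
    using assms that by (intro edge_Int_edge) auto
  then show ?thesis unfolding drawn_edges_def by blast
qed

lemma drawn_edges_Int_V: "A \<subseteq> E \<Longrightarrow> drawn_edges \<gamma> A \<inter> V = \<Union>A"
  unfolding drawn_edges_def using edge_Int_V by fast

lemma drawn_edges_insert [simp]: "drawn_edges \<gamma> (insert e A) = path_image (\<gamma> e) \<union> drawn_edges \<gamma> A"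
  by (simp add: drawn_edges_def)

text \<open>The curve \<open>\<gamma> e\<close> belongs to an unordered pair, so its direction is
  arbitrary; it is reversed where necessary, so that the edges of a path can be joined head to
  tail.\<close>

lemma oriented_edge:
  assumes "{u, v} \<in> E"
  obtains g where "arc g" "pathstart g = u" "pathfinish g = v" "path_image g = path_image (\<gamma> {u, v})"
proof (cases "pathstart (\<gamma> {u, v}) = u")
  case True
  then have "pathfinish (\<gamma> {u, v}) = v"
    using ends_edge[OF assms] edge_distinct_ends[OF assms] by (auto simp: doubleton_eq_iff)
  then show thesis using True arc_edge[OF assms] that by blast
next
  case False
  then have "pathstart (\<gamma> {u, v}) = v" "pathfinish (\<gamma> {u, v}) = u"
    using ends_edge[OF assms] by (auto simp: doubleton_eq_iff)
  then show thesis using arc_edge[OF assms] that[of "reversepath (\<gamma> {u, v})"]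
    by (simp add: arc_reversepath)
qed

lemma drawn_path_arc:
  assumes "distinct p" "2 \<le> length p" "path_edges p \<subseteq> E"
  obtains g where "arc g" "pathstart g = hd p" "pathfinish g = last p"
    "path_image g = drawn_edges \<gamma> (path_edges p)"
proof -
  have "\<exists>g. arc g \<and> pathstart g = hd p \<and> pathfinish g = last p \<and>
            path_image g = drawn_edges \<gamma> (path_edges p)"
    using assms
  proof (induction p)
    case (Cons u q)
    then obtain v r where q: "q = v # r" by (cases q) auto
    have uv: "{u, v} \<in> E" and qE: "path_edges q \<subseteq> E" using Cons.prems q by auto
    obtain g where g: "arc g" "pathstart g = u" "pathfinish g = v" "path_image g = path_image (\<gamma> {u, v})"
      using oriented_edge[OF uv] .
    show ?case
    proof (cases r)
      case Nil
      then show ?thesis using g q by (auto simp: drawn_edges_def)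
    next
      case (Cons w s)
      then obtain h where h: "arc h" "pathstart h = v" "pathfinish h = last q"
        "path_image h = drawn_edges \<gamma> (path_edges q)"
        using Cons.IH Cons.prems q qE by auto
      have "{u, v} \<notin> path_edges q"
        using path_edges_subset[of "{u, v}" q] Cons.prems by auto
      then have "path_image g \<inter> path_image h = {u, v} \<inter> \<Union>(path_edges q)"
        using drawn_edges_Int[of "{{u, v}}" "path_edges q"] uv qE g h by (simp add: drawn_edges_def)
      \<comment> \<open>Since \<open>p\<close> is distinct, \<open>u\<close> does not occur in
        \<open>q\<close>, so the first edge touches the rest of the path only at \<open>v\<close>;
        this is the condition for joining two arcs to an arc.\<close>
      also have "\<dots> \<subseteq> {v}" using path_edges_subset[of _ q] Cons.prems by auto
      finally have "arc (g +++ h)" using g h by (intro arc_join) auto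
      then show ?thesis
        using g h q by (intro exI[of _ "g +++ h"]) (simp add: path_image_join)
    qed
  qed simp
  then show thesis using that by blast
qed

text \<open>The arc of the path and the closing edge have exactly their two ends in common, so their
  join is a simple closed curve.\<close>

lemma drawn_cycle:
  assumes "is_cycle V E vs"
  obtains g where "simple_path g" "pathfinish g = pathstart g"
    "path_image g = drawn_edges \<gamma> (cycle_edges vs)"
proof -
  have vs: "distinct vs" "3 \<le> length vs" "vs \<noteq> []" and E: "cycle_edges vs \<subseteq> E"
    using assms by (auto simp: is_cycle_def)
  have ce: "cycle_edges vs = insert {last vs, hd vs} (path_edges vs)"
    using vs by (simp add: cycle_edges_eq_insert)
  obtain g where g: "arc g" "pathstart g = hd vs" "pathfinish g = last vs"
    "path_image g = drawn_edges \<gamma> (path_edges vs)"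
    using drawn_path_arc[of vs] vs E ce by auto
  obtain h where h: "arc h" "pathstart h = last vs" "pathfinish h = hd vs"
    "path_image h = path_image (\<gamma> {last vs, hd vs})"
    using oriented_edge[of "last vs" "hd vs"] E ce by auto
  have "path_image g \<inter> path_image h = \<Union>(path_edges vs) \<inter> {last vs, hd vs}"
    using drawn_edges_Int[of "path_edges vs" "{{last vs, hd vs}}"] E ce g h
      closing_edge_notin_path_edges[OF vs(1,2)] by (simp add: drawn_edges_def)
  then have "simple_path (g +++ h)"
    using g h by (intro simple_path_join_loop) auto
  then show thesis
    using g h ce by (intro that[of "g +++ h"]) (auto simp: path_image_join)
qed

text \<open>Without \<open>e\<close> the cycle is a path between the ends of \<open>e\<close>, and
  its drawing is an arc. Both facts prepare Janiszewski's theorem, which asks for a connected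
  intersection.\<close>

lemma connected_cycle_minus_edge:
  assumes "is_cycle V E vs" "e \<in> cycle_edges vs"
  shows "connected (drawn_edges \<gamma> (cycle_edges vs - {e}))" "e \<subseteq> \<Union>(cycle_edges vs - {e})"
proof -
  obtain ws where ws: "set ws = set vs" "length ws = length vs" "distinct ws = distinct vs"
    "cycle_edges ws = cycle_edges vs" "e = {last ws, hd ws}"
    using cycle_edge_rotated_last[OF assms(2)] .
  then have w: "distinct ws" "3 \<le> length ws" "ws \<noteq> []" and E: "cycle_edges ws \<subseteq> E"
    using assms(1) by (auto simp: is_cycle_def)
  then have ce: "cycle_edges vs - {e} = path_edges ws"
    using ws(4,5) cycle_edges_eq_insert[of ws] closing_edge_notin_path_edges[of ws] by auto
  have "2 \<le> length ws" "path_edges ws \<subseteq> E"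
    using w E cycle_edges_eq_insert[of ws] by auto
  from drawn_path_arc[OF w(1) this]
  obtain g where "arc g" "path_image g = drawn_edges \<gamma> (path_edges ws)" by blast
  then show "connected (drawn_edges \<gamma> (cycle_edges vs - {e}))" using ce connected_arc_image by metis
  show "e \<subseteq> \<Union>(cycle_edges vs - {e})"
    unfolding ce using w ws(5) Union_path_edges[of ws] by auto
qed

end

section \<open>Faces and edges of a plane graph\<close>

text \<open>The inverse of \<open>g\<close> would embed a nonempty open set of the plane into the
  line, contrary to invariance of dimension.\<close>

lemma interior_arc_image:
  fixes g :: "real \<Rightarrow> complex"
  assumes "arc g"
  shows "interior (path_image g) = {}"
proof (rule ccontr)
  assume ne: "interior (path_image g) \<noteq> {}"
  obtain h where h: "homeomorphism {0..1} (path_image g) g h"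
    using homeomorphism_arc[OF assms] .
  have "continuous_on (interior (path_image g)) h"
    using homeomorphism_cont2[OF h] interior_subset by (rule continuous_on_subset)
  moreover have "inj_on h (interior (path_image g))"
    using homeomorphism_apply2[OF h] interior_subset by (intro inj_on_inverseI[of _ g]) blast
  ultimately have "DIM(complex) \<le> DIM(real)"
    using ne by (intro invariance_of_dimension[of "interior (path_image g)" h]) auto
  then show False by simp
qed

lemma Jordan_sides:
  fixes c :: "real \<Rightarrow> complex"
  assumes "simple_path c" "pathfinish c = pathstart c"
  shows "connected (inside (path_image c))" "connected (outside (path_image c))"
    "open (inside (path_image c))" "open (outside (path_image c))"
    "bounded (inside (path_image c))" "\<not> bounded (outside (path_image c))"
    "frontier (inside (path_image c)) = path_image c" "frontier (outside (path_image c)) = path_image c"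
  using Jordan_inside_outside[OF assms] by - (elim conjE, assumption)+

text \<open>A connected set that meets another set without meeting its frontier is contained in it.
  \<open>F\<close> and the side of the curve that it meets have the same frontier and both avoid it,
  so each contains the other. Boundedness then tells which side it is.\<close>

lemma connected_frontier_Jordan:
  fixes c :: "real \<Rightarrow> complex"
  assumes c: "simple_path c" "pathfinish c = pathstart c"
    and F: "connected F" "F \<noteq> {}" "F \<inter> path_image c = {}" "frontier F = path_image c"
  shows "F = (if bounded F then inside (path_image c) else outside (path_image c))"
proof -
  note J = Jordan_sides[OF c]
  have eq: "F = W"
    if W: "connected W" "F \<inter> W \<noteq> {}" "frontier W = path_image c" "W \<inter> path_image c = {}" for W
  proof -
    have "W \<subseteq> F" using connected_Int_frontier[of W F] W F by blast
    moreover have "F \<subseteq> W" using connected_Int_frontier[of F W] W F by blast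
    ultimately show ?thesis by blast
  qed
  have "F \<inter> inside (path_image c) \<noteq> {} \<or> F \<inter> outside (path_image c) \<noteq> {}"
    using inside_Un_outside[of "path_image c"] F by blast
  then have "F = inside (path_image c) \<or> F = outside (path_image c)"
  proof
    assume "F \<inter> inside (path_image c) \<noteq> {}"
    then show ?thesis using eq[of "inside (path_image c)"] J inside_no_overlap by simp
  next
    assume "F \<inter> outside (path_image c) \<noteq> {}"
    then show ?thesis using eq[of "outside (path_image c)"] J outside_no_overlap by simp
  qed
  then show ?thesis
  proof
    assume "F = inside (path_image c)"
    then show ?thesis using J(5) by simp
  next
    assume "F = outside (path_image c)"
    then show ?thesis using J(6) by simp
  qed
qed

context plane
begin

text \<open>An inner point of an edge lies on no other edge, so a single such point decides whether
  \<open>e\<close> belongs to \<open>A\<close>.\<close>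

lemma mem_edges_if_drawn:
  assumes "e \<in> E" "A \<subseteq> E" "x \<in> path_image (\<gamma> e)" "x \<notin> e" "x \<in> drawn_edges \<gamma> A"
  shows "e \<in> A"
  using assms edge_Int_edge unfolding drawn_edges_def by blast

lemma edge_inner_point:
  assumes "e \<in> E"
  obtains x where "x \<in> path_image (\<gamma> e)" "x \<notin> e"
  using nonempty_simple_path_endless[OF arc_imp_simple_path[OF arc_edge[OF assms]]]
    ends_edge[OF assms] by blast

abbreviation "drawing \<equiv> V \<union> drawn_edges \<gamma> E"

lemma compact_drawing: "compact drawing"
  using compact_drawn_edges[of E] finite_V by (simp add: compact_Un finite_imp_compact)

text \<open>The vertices and the other edges form a closed set that misses \<open>x\<close>. Inside
  the ball the drawing therefore consists of inner points of \<open>e\<close> only.\<close>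

lemma ball_off_other_edges:
  assumes "e \<in> E" "x \<in> path_image (\<gamma> e)" "x \<notin> e"
  obtains r where "0 < r" "ball x r \<inter> (V \<union> drawn_edges \<gamma> (E - {e})) = {}"
proof -
  let ?R = "V \<union> drawn_edges \<gamma> (E - {e})"
  have "closed ?R"
    using compact_drawn_edges[of "E - {e}"] finite_V
    by (simp add: closed_Un compact_imp_closed finite_imp_closed)
  moreover have "x \<notin> ?R"
    using assms edge_Int_V mem_edges_if_drawn[of e "E - {e}" x] by blast
  ultimately obtain r where "0 < r" "ball x r \<subseteq> - ?R"
    using open_contains_ball_eq[of "- ?R" x] open_Compl[of ?R] by blast
  then show thesis using that by blast
qed

text \<open>Janiszewski's theorem: the cycle and the rest of the drawing meet in the connected set that
  remains of the cycle when \<open>e\<close> is removed.\<close>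

lemma connected_off_drawing:
  assumes vs: "is_cycle V E vs" and e: "e \<in> cycle_edges vs"
    and ab: "connected_component (- drawn_edges \<gamma> (cycle_edges vs)) a b"
      "connected_component (- (V \<union> drawn_edges \<gamma> (E - {e}))) a b"
  shows "connected_component (- drawing) a b"
proof -
  let ?J = "drawn_edges \<gamma> (cycle_edges vs)" and ?R = "V \<union> drawn_edges \<gamma> (E - {e})"
  have E: "cycle_edges vs \<subseteq> E" "e \<in> E" using vs e by (auto simp: is_cycle_def)
  have J: "?J = path_image (\<gamma> e) \<union> drawn_edges \<gamma> (cycle_edges vs - {e})"
    using e by (metis drawn_edges_insert insert_Diff)
  have "drawn_edges \<gamma> (cycle_edges vs - {e}) \<subseteq> ?R"
    using E by (auto simp: drawn_edges_def)
  \<comment> \<open>The edge \<open>e\<close> meets \<open>?R\<close> at most in its ends, and these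
    are still covered by the remaining edges of the cycle.\<close>
  moreover have "path_image (\<gamma> e) \<inter> ?R \<subseteq> drawn_edges \<gamma> (cycle_edges vs - {e})"
  proof -
    have "path_image (\<gamma> e) \<inter> ?R \<subseteq> e"
      using edge_Int_V[OF E(2)] mem_edges_if_drawn[OF E(2), of "E - {e}"] by blast
    also have "\<dots> \<subseteq> \<Union>(cycle_edges vs - {e})"
      by (rule connected_cycle_minus_edge[OF vs e])
    also have "\<dots> \<subseteq> drawn_edges \<gamma> (cycle_edges vs - {e})"
      using drawn_edges_Int_V[of "cycle_edges vs - {e}"] E by blast
    finally show ?thesis .
  qed
  ultimately have "?J \<inter> ?R = drawn_edges \<gamma> (cycle_edges vs - {e})"
    unfolding J by blast
  moreover have "closed ?R"
    using compact_drawn_edges[of "E - {e}"] finite_V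
    by (simp add: closed_Un compact_imp_closed finite_imp_closed)
  ultimately have "connected_component (- (?J \<union> ?R)) a b"
    using Janiszewski[of ?J ?R a b] connected_cycle_minus_edge(1)[OF vs e] compact_drawn_edges[OF E(1)] ab
    by simp
  moreover have "?J \<union> ?R = drawing"
  proof -
    have "drawn_edges \<gamma> E = path_image (\<gamma> e) \<union> drawn_edges \<gamma> (E - {e})"
      using E(2) by (metis drawn_edges_insert insert_Diff)
    then show ?thesis using E unfolding J by (auto simp: drawn_edges_def)
  qed
  ultimately show ?thesis by simp
qed

lemma face_props:
  assumes "F \<in> faces V E \<gamma>"
  shows "open F" "connected F" "F \<noteq> {}" "F \<inter> drawing = {}" "frontier F \<subseteq> drawing"
proof -
  have F: "F \<in> components (- drawing)" using assms by (simp add: faces_def)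
  have o: "open (- drawing)" using compact_drawing compact_imp_closed by blast
  show "open F" "connected F" "F \<noteq> {}"
    using open_components[OF o F] in_components_connected[OF F] in_components_nonempty[OF F] .
  show "F \<inter> drawing = {}" using in_components_subset[OF F] by blast
  have "frontier F \<subseteq> frontier drawing"
    using frontier_of_components_subset[OF F] unfolding frontier_complement .
  also have "\<dots> \<subseteq> drawing"
    using compact_drawing by (simp add: compact_imp_closed frontier_subset_closed del: frontier_Un_subset)
  finally show "frontier F \<subseteq> drawing" .
qed

lemma face_of_point:
  assumes "x \<notin> drawing"
  obtains F where "F \<in> faces V E \<gamma>" "x \<in> F"
proof -
  have "x \<in> \<Union>(faces V E \<gamma>)" using assms Union_components[of "- drawing"] unfolding faces_def by blast
  then show thesis using that by blast
qed

lemma faces_eqI: "F \<in> faces V E \<gamma> \<Longrightarrow> G \<in> faces V E \<gamma> \<Longrightarrow> x \<in> F \<Longrightarrow> x \<in> G \<Longrightarrow> F = G"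
  unfolding faces_def using components_eq by blast

lemma faces_eq_connected:
  assumes "F \<in> faces V E \<gamma>" "G \<in> faces V E \<gamma>" "a \<in> F" "b \<in> G" "connected_component (- drawing) a b"
  shows "F = G"
proof -
  obtain T where T: "connected T" "T \<subseteq> - drawing" "a \<in> T" "b \<in> T"
    using assms(5) unfolding connected_component_def by blast
  have "T \<subseteq> F"
    using components_maximal[of F "- drawing" T] T assms(1,3) unfolding faces_def by blast
  then show ?thesis using faces_eqI[OF assms(1,2)] assms(4) T(4) by blast
qed

end

section \<open>Faces of a semi-maximal planar graph\<close>

locale smpg = plane +
  fixes C :: "complex list"
  assumes smpg: "semi_maximal_planar_graph V E \<gamma> C"
begin

text \<open>Read off from the frontier, so that no bounding cycle has to be chosen; by
  \<open>face_edges_eq\<close> every bounding cycle has exactly these edges.\<close>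

definition face_edges :: "complex set \<Rightarrow> complex set set" where
  "face_edges F = {e \<in> E. path_image (\<gamma> e) \<subseteq> frontier F}"

lemma cycle_C: "is_cycle V E C"
  using smpg by (simp add: semi_maximal_planar_graph_def)

lemma face_edges_eq:
  assumes "is_cycle V E vs" "face_bounded_by \<gamma> F vs"
  shows "face_edges F = cycle_edges vs"
proof -
  have E: "cycle_edges vs \<subseteq> E" using assms by (simp add: is_cycle_def)
  have fr: "frontier F = drawn_edges \<gamma> (cycle_edges vs)" using assms by (simp add: face_bounded_by_def)
  show ?thesis
  proof
    show "face_edges F \<subseteq> cycle_edges vs"
    proof
      fix e assume e: "e \<in> face_edges F"
      then have eE: "e \<in> E" and sub: "path_image (\<gamma> e) \<subseteq> drawn_edges \<gamma> (cycle_edges vs)"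
        unfolding face_edges_def fr by auto
      obtain x where "x \<in> path_image (\<gamma> e)" "x \<notin> e" using edge_inner_point[OF eE] .
      then show "e \<in> cycle_edges vs" using mem_edges_if_drawn[OF eE E] sub by blast
    qed
    show "cycle_edges vs \<subseteq> face_edges F"
      using E unfolding face_edges_def fr drawn_edges_def by blast
  qed
qed

lemma face_cycle:
  assumes "F \<in> faces V E \<gamma>"
  obtains vs where "is_cycle V E vs" "face_bounded_by \<gamma> F vs" "face_edges F = cycle_edges vs"
proof (cases "bounded F")
  case True
  then obtain T where "is_cycle V E T" "face_bounded_by \<gamma> F T"
    using assms smpg unfolding semi_maximal_planar_graph_def by blast
  then show thesis using face_edges_eq that by blast
next
  case False
  then have "face_bounded_by \<gamma> F C"
    using assms smpg unfolding semi_maximal_planar_graph_def by blast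
  then show thesis using cycle_C face_edges_eq that by blast
qed

lemma frontier_face:
  assumes "F \<in> faces V E \<gamma>"
  shows "frontier F = drawn_edges \<gamma> (face_edges F)"
proof -
  obtain vs where "face_bounded_by \<gamma> F vs" "face_edges F = cycle_edges vs"
    using face_cycle[OF assms] .
  then show ?thesis by (simp add: face_bounded_by_def)
qed

text \<open>The frontier of a face is a union of whole edges, so it contains an edge as soon as it
  contains one inner point of it.\<close>

lemma mem_face_edges_iff:
  assumes "F \<in> faces V E \<gamma>" "e \<in> E" "x \<in> path_image (\<gamma> e)" "x \<notin> e"
  shows "e \<in> face_edges F \<longleftrightarrow> x \<in> frontier F"
proof
  show "x \<in> frontier F" if "e \<in> face_edges F" using that assms(3) by (auto simp: face_edges_def)
  have "face_edges F \<subseteq> E" by (auto simp: face_edges_def)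
  then show "e \<in> face_edges F" if "x \<in> frontier F"
    using mem_edges_if_drawn[OF assms(2) _ assms(3,4)] that unfolding frontier_face[OF assms(1)] by blast
qed

lemma face_frontier_Jordan:
  assumes "F \<in> faces V E \<gamma>"
  obtains c where "simple_path c" "pathfinish c = pathstart c" "path_image c = frontier F"
proof -
  obtain vs where vs: "is_cycle V E vs" "face_bounded_by \<gamma> F vs" using face_cycle[OF assms] .
  obtain c where "simple_path c" "pathfinish c = pathstart c"
    "path_image c = drawn_edges \<gamma> (cycle_edges vs)"
    using drawn_cycle[OF vs(1)] .
  then show thesis using that vs(2) unfolding face_bounded_by_def by simp
qed

lemma face_eq_side:
  assumes "F \<in> faces V E \<gamma>"
  shows "F = (if bounded F then inside (frontier F) else outside (frontier F))"
proof -
  obtain c where c: "simple_path c" "pathfinish c = pathstart c" "path_image c = frontier F"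
    using face_frontier_Jordan[OF assms] .
  have "F \<inter> frontier F = {}" using face_props(4,5)[OF assms] by blast
  then show ?thesis
    using connected_frontier_Jordan[OF c(1,2) face_props(2,3)[OF assms]] unfolding c(3) by simp
qed

text \<open>\<open>W\<close> is the side of the Jordan curve \<open>frontier F\<close> opposite to
  \<open>F\<close>. Bounded faces and the outer face can thus be handled alike.\<close>

lemma face_sides:
  assumes "F \<in> faces V E \<gamma>"
  obtains W where
    "connected W" "- frontier F = F \<union> W" "F \<inter> W = {}" "frontier W = frontier F" "open W"
proof -
  obtain c where c: "simple_path c" "pathfinish c = pathstart c" "path_image c = frontier F"
    using face_frontier_Jordan[OF assms] .
  note F = face_eq_side[OF assms]
  note J = Jordan_sides[OF c(1,2), unfolded c(3)] inside_Un_outside[of "frontier F"] inside_Int_outside[of "frontier F"]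
  show thesis
  proof (cases "bounded F")
    case True
    then have "F = inside (frontier F)" using F by simp
    then show thesis using J by (intro that[of "outside (frontier F)"]) simp_all
  next
    case False
    then have "F = outside (frontier F)" using F by simp
    then show thesis using J by (intro that[of "inside (frontier F)"]) (simp_all add: Un_commute Int_commute)
  qed
qed

section \<open>Every edge lies on exactly two faces\<close>

lemma face_edge_exists:
  assumes e: "e \<in> E"
  obtains F where "F \<in> faces V E \<gamma>" "e \<in> face_edges F"
proof -
  obtain x where x: "x \<in> path_image (\<gamma> e)" "x \<notin> e" using edge_inner_point[OF e] .
  obtain r where r: "0 < r" "ball x r \<inter> (V \<union> drawn_edges \<gamma> (E - {e})) = {}"
    using ball_off_other_edges[OF e x] .
  have B: "ball x r \<inter> drawing \<subseteq> path_image (\<gamma> e) - e"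
    using r edge_subset_V[OF e] by (auto simp: drawn_edges_def)
  \<comment> \<open>An arc has empty interior, so the ball contains a point \<open>p\<close> off
    \<open>e\<close>, which then lies in some face.\<close>
  have "\<not> ball x r \<subseteq> path_image (\<gamma> e)"
    using interior_arc_image[OF arc_edge[OF e]] interior_maximal[of "ball x r" "path_image (\<gamma> e)"] r
    by (metis centre_in_ball empty_iff open_ball subsetD)
  then obtain p where p: "p \<in> ball x r" "p \<notin> drawing" using B by blast
  obtain F where F: "F \<in> faces V E \<gamma>" "p \<in> F" using face_of_point[OF p(2)] .
  have "x \<notin> F" using face_props(4)[OF F(1)] x e by (auto simp: drawn_edges_def)
  \<comment> \<open>The ball is connected and contains \<open>p\<close> in \<open>F\<close> and
    \<open>x\<close> outside \<open>F\<close>, so it meets the frontier of \<open>F\<close>,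
    necessarily at an inner point of \<open>e\<close>.\<close>
  then obtain y where y: "y \<in> ball x r" "y \<in> frontier F"
    using connected_Int_frontier[OF connected_ball, of x r F] p(1) F(2) centre_in_ball[of x r] r(1) by blast
  then have "y \<in> path_image (\<gamma> e)" "y \<notin> e" using face_props(5)[OF F(1)] B by auto
  then have "e \<in> face_edges F" using mem_face_edges_iff[OF F(1) e] y by blast
  then show thesis using that F by blast
qed

text \<open>One face \<open>F\<close> at \<open>e\<close> is given. Close to an inner point
  \<open>x\<close> of \<open>e\<close>, everything off the frontier of \<open>F\<close> is in
  \<open>F\<close> or on the opposite side \<open>W\<close>, and the part in \<open>W\<close> turns
  out to lie in a single face \<open>G\<close>.\<close>

lemma card_faces_of_edge:
  assumes e: "e \<in> E"
  shows "card {F \<in> faces V E \<gamma>. e \<in> face_edges F} = 2"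
proof -
  obtain F where F: "F \<in> faces V E \<gamma>" "e \<in> face_edges F" using face_edge_exists[OF e] .
  obtain vs where vs: "is_cycle V E vs" "face_bounded_by \<gamma> F vs" "face_edges F = cycle_edges vs"
    using face_cycle[OF F(1)] .
  obtain x where x: "x \<in> path_image (\<gamma> e)" "x \<notin> e" using edge_inner_point[OF e] .
  obtain r where r: "0 < r" "ball x r \<inter> (V \<union> drawn_edges \<gamma> (E - {e})) = {}"
    using ball_off_other_edges[OF e x] .
  obtain W where W: "connected W" "- frontier F = F \<union> W" "F \<inter> W = {}" "frontier W = frontier F" "open W"
    using face_sides[OF F(1)] .
  have xF: "x \<in> frontier F" using mem_face_edges_iff[OF F(1) e x] F by blast
  have B: "ball x r \<inter> drawing \<subseteq> frontier F"
    using r F(2) unfolding face_edges_def drawn_edges_def by auto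
  \<comment> \<open>The two hypotheses of the Janiszewski step have different witnesses:
    \<open>W\<close> avoids the cycle, and the ball avoids the rest of the drawing.\<close>
  have conn: "connected_component (- drawing) a b" if "a \<in> ball x r \<inter> W" "b \<in> ball x r \<inter> W" for a b
  proof (rule connected_off_drawing[OF vs(1)])
    show "e \<in> cycle_edges vs" using F vs by simp
    show "connected_component (- drawn_edges \<gamma> (cycle_edges vs)) a b"
      using W that vs(2) unfolding face_bounded_by_def connected_component_def by (intro exI[of _ W]) auto
    show "connected_component (- (V \<union> drawn_edges \<gamma> (E - {e}))) a b"
      using r that unfolding connected_component_def by (intro exI[of _ "ball x r"]) auto
  qed
  have near: "U \<inter> T \<noteq> {}" if "x \<in> frontier U" "open T" "x \<in> T" for U T
    using that open_Int_closure_eq_empty[of T U] by (auto simp: frontier_def Int_commute)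
  obtain q where q: "q \<in> ball x r \<inter> W" using near[of W "ball x r"] xF W(4) r(1) by fastforce
  then have "q \<notin> drawing" using B W(2) by blast
  then obtain G where G: "G \<in> faces V E \<gamma>" "q \<in> G" using face_of_point by blast
  have ball_G: "ball x r \<inter> W \<subseteq> G"
  proof
    fix a assume a: "a \<in> ball x r \<inter> W"
    then have "a \<notin> drawing" using B W(2) by blast
    then obtain H where H: "H \<in> faces V E \<gamma>" "a \<in> H" using face_of_point by blast
    then show "a \<in> G" using faces_eq_connected[OF H(1) G(1) H(2) G(2) conn[OF a q]] by blast
  qed
  have "F \<noteq> G" using q G W by blast
  moreover have "e \<in> face_edges G"
  proof -
    have "x \<in> closure (ball x r \<inter> W)"
      using open_Int_closure_subset[of "ball x r" W] xF W(4) r(1) by (auto simp: frontier_def)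
    then have "x \<in> closure G" using ball_G closure_mono by blast
    moreover have "x \<notin> G" using face_props(4)[OF G(1)] x e by (auto simp: drawn_edges_def)
    ultimately have "x \<in> frontier G" using face_props(1)[OF G(1)] by (simp add: frontier_def interior_open)
    then show ?thesis using mem_face_edges_iff[OF G(1) e x] by blast
  qed
  \<comment> \<open>A face with \<open>x\<close> on its frontier has a point in the ball; that point
    is in \<open>F\<close> or in \<open>W\<close>, hence in \<open>F\<close> or in
    \<open>G\<close>.\<close>
  moreover have "H = F \<or> H = G" if H: "H \<in> faces V E \<gamma>" "e \<in> face_edges H" for H
  proof -
    have "x \<in> frontier H" using mem_face_edges_iff[OF H(1) e x] H by blast
    then obtain a where a: "a \<in> H" "a \<in> ball x r" using near[of H "ball x r"] r(1) by fastforce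
    then have "a \<notin> frontier F" using face_props(4)[OF H(1)] face_props(5)[OF F(1)] by blast
    then have "a \<in> F \<or> a \<in> G" using W(2) ball_G a by blast
    then show ?thesis using faces_eqI H F G a by blast
  qed
  ultimately have "{F \<in> faces V E \<gamma>. e \<in> face_edges F} = {F, G}"
    using F G by blast
  then show ?thesis using \<open>F \<noteq> G\<close> by simp
qed

section \<open>Counting incidences of edges and faces\<close>

lemma finite_bounded_faces: "finite {F \<in> faces V E \<gamma>. bounded F}"
proof (rule finite_imageD)
  show "finite (face_edges ` {F \<in> faces V E \<gamma>. bounded F})"
    by (rule finite_subset[of _ "Pow E"]) (auto simp: face_edges_def finite_E)
  \<comment> \<open>The edges of a bounded face determine its frontier, and the face is the inside
    of that frontier.\<close>
  show "inj_on face_edges {F \<in> faces V E \<gamma>. bounded F}"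
  proof (rule inj_onI, clarify)
    fix F G assume *: "F \<in> faces V E \<gamma>" "G \<in> faces V E \<gamma>" "bounded F" "bounded G" "face_edges F = face_edges G"
    then have "frontier F = frontier G" using frontier_face by simp
    moreover have "F = inside (frontier F)" "G = inside (frontier G)"
      using face_eq_side[OF *(1)] face_eq_side[OF *(2)] *(3,4) by simp_all
    ultimately show "F = G" by simp
  qed
qed

text \<open>The drawing is compact, so its complement in the plane has exactly one unbounded
  component.\<close>

lemma outer_face:
  obtains F where "F \<in> faces V E \<gamma>" "\<not> bounded F" "face_edges F = cycle_edges C"
    "\<forall>G\<in>faces V E \<gamma>. \<not> bounded G \<longrightarrow> G = F"
proof -
  have b: "bounded (- (- drawing))" using compact_imp_bounded[OF compact_drawing] by (simp only: boolean_algebra_class.boolean_algebra.double_compl)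
  obtain x where x: "x \<in> - drawing" "\<not> bounded (connected_component_set (- drawing) x)"
    using cobounded_unbounded_component[OF b] by auto
  let ?F = "connected_component_set (- drawing) x"
  have F: "?F \<in> faces V E \<gamma>" using x by (auto simp: faces_def components_def)
  have "face_bounded_by \<gamma> ?F C"
    using smpg F x(2) unfolding semi_maximal_planar_graph_def by blast
  then show thesis
    using F x(2) cobounded_unique_unbounded_components[OF b]
    by (intro that[of ?F]) (auto simp: face_edges_eq cycle_C faces_def)
qed

text \<open>Pairs of an edge in \<open>M\<close> and a face at it are counted twice over. By edges
  their number is twice the size of \<open>M\<close>; by faces it is a sum of even numbers plus the
  contribution of the outer face, whose edges are those of \<open>C\<close>.\<close>

lemma even_card_boundary_edges:
  assumes M: "M \<subseteq> E"
    and even: "\<And>F. F \<in> faces V E \<gamma> \<Longrightarrow> bounded F \<Longrightarrow> even (card (M \<inter> face_edges F))"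
  shows "even (card (M \<inter> cycle_edges C))"
proof -
  define B where "B = {F \<in> faces V E \<gamma>. bounded F}"
  have fin: "finite B" "finite M" using finite_bounded_faces finite_E M finite_subset by (auto simp: B_def)
  obtain Q where Q: "Q \<in> faces V E \<gamma>" "\<not> bounded Q" "face_edges Q = cycle_edges C"
    "\<forall>G\<in>faces V E \<gamma>. \<not> bounded G \<longrightarrow> G = Q"
    by (rule outer_face)
  \<comment> \<open>The sum over \<open>B\<close> leaves out the outer face \<open>Q\<close>; the
    summand \<open>of_bool\<close> accounts for it.\<close>
  have two: "card {F \<in> B. e \<in> face_edges F} + of_bool (e \<in> cycle_edges C) = 2" if "e \<in> M" for e
  proof -
    let ?B = "{F \<in> B. e \<in> face_edges F}"
    have c: "card {F \<in> faces V E \<gamma>. e \<in> face_edges F} = 2"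
      using card_faces_of_edge that M by blast
    have B: "Q \<notin> ?B" using Q(2) by (simp add: B_def)
    have finB: "finite ?B" using fin(1) by simp
    show ?thesis
    proof (cases "e \<in> cycle_edges C")
      case True
      then have "{F \<in> faces V E \<gamma>. e \<in> face_edges F} = insert Q ?B"
        using Q unfolding B_def by blast
      then show ?thesis using c B finB True by simp
    next
      case False
      then have "{F \<in> faces V E \<gamma>. e \<in> face_edges F} = ?B"
        using Q unfolding B_def by blast
      then show ?thesis using c False by simp
    qed
  qed
  have count: "card {x \<in> X. P x} = (\<Sum>x\<in>X. of_bool (P x))" if "finite X" for X :: "'x set" and P
    using that by (simp add: sum.If_cases of_bool_def Int_def)
  have "(\<Sum>F\<in>B. card (M \<inter> face_edges F)) + card (M \<inter> cycle_edges C) =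
        (\<Sum>F\<in>B. \<Sum>e\<in>M. of_bool (e \<in> face_edges F)) + (\<Sum>e\<in>M. of_bool (e \<in> cycle_edges C))"
    unfolding Int_def count[OF fin(2)] by (rule refl)
  also have "\<dots> = (\<Sum>e\<in>M. \<Sum>F\<in>B. of_bool (e \<in> face_edges F)) + (\<Sum>e\<in>M. of_bool (e \<in> cycle_edges C))"
    by (subst sum.swap) (rule refl)
  also have "\<dots> = (\<Sum>e\<in>M. card {F \<in> B. e \<in> face_edges F} + of_bool (e \<in> cycle_edges C))"
    unfolding count[OF fin(1)] by (rule sum.distrib[symmetric])
  also have "\<dots> = (\<Sum>e\<in>M. 2)" using two by (intro sum.cong) auto
  finally have "even ((\<Sum>F\<in>B. card (M \<inter> face_edges F)) + card (M \<inter> cycle_edges C))" by simp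
  moreover have "even (\<Sum>F\<in>B. card (M \<inter> face_edges F))"
    using even by (intro dvd_sum) (auto simp: B_def)
  ultimately show ?thesis by simp
qed

end

section \<open>Bicoloured paths\<close>

lemma bicoloured_paths_extend:
  assumes p: "bicoloured_paths V E f i j u w \<noteq> {}"
    and w': "{w, w'} \<in> E" "w' \<in> V" "f w' \<in> {i, j}"
  shows "bicoloured_paths V E f i j u w' \<noteq> {}"
proof -
  obtain p where p: "p \<noteq> []" "hd p = u" "last p = w" "distinct p" "set p \<subseteq> V"
    "successively (\<lambda>x y. {x, y} \<in> E) p" "f ` set p \<subseteq> {i, j}"
    using assms(1) unfolding bicoloured_paths_def paths_def by blast
  show ?thesis
  proof (cases "w' \<in> set p")
    \<comment> \<open>Paths have no repeated vertices, so a path that has already visited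
      \<open>w'\<close> is cut off there instead of being prolonged.\<close>
    case True
    then obtain ys zs where ys: "p = ys @ w' # zs" by (meson split_list)
    then have "ys @ [w'] \<in> bicoloured_paths V E f i j u w'"
      using p unfolding bicoloured_paths_def paths_def
      by (auto simp: successively_append_iff hd_append)
    then show ?thesis by blast
  next
    case False
    then have "p @ [w'] \<in> bicoloured_paths V E f i j u w'"
      using p w' unfolding bicoloured_paths_def paths_def
      by (auto simp: successively_append_iff)
    then show ?thesis by blast
  qed
qed

lemma bicoloured_paths_end:
  "bicoloured_paths V E f i j u w \<noteq> {} \<Longrightarrow> w \<in> V \<and> f w \<in> {i, j}"
  unfolding bicoloured_paths_def paths_def using last_in_set by fast

lemma bicoloured_paths_refl:
  "u \<in> V \<Longrightarrow> f u \<in> {i, j} \<Longrightarrow> bicoloured_paths V E f i j u u \<noteq> {}"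
proof -
  assume "u \<in> V" "f u \<in> {i, j}"
  then have "[u] \<in> bicoloured_paths V E f i j u u" by (simp add: bicoloured_paths_def paths_def)
  then show ?thesis by blast
qed

lemma (in plane) drawn_paths_Int:
  assumes "path_edges p \<subseteq> E" "path_edges q \<subseteq> E" "path_edges p \<inter> path_edges q = {}"
    "2 \<le> length p" "2 \<le> length q"
  shows "drawn_edges \<gamma> (path_edges p) \<inter> drawn_edges \<gamma> (path_edges q) = set p \<inter> set q"
  using drawn_edges_Int[OF assms(1-3)] Union_path_edges assms(4,5) by metis

lemma cycle_edges_4:
  "cycle_edges [v1, v2, v3, v4] = {{v1, v2}, {v2, v3}, {v3, v4}, {v4, v1}}"
  by (auto simp: cycle_edges_eq_insert)

lemma cycle_edges_3: "cycle_edges [a, b, c] = {{a, b}, {b, c}, {c, a}}"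
  by (auto simp: cycle_edges_eq_insert)

context smpg
begin

section \<open>Crossing paths in the disc bounded by the outer cycle\<close>

lemma drawing_subset_closed_disc:
  "drawing \<subseteq> drawn_edges \<gamma> (cycle_edges C) \<union> inside (drawn_edges \<gamma> (cycle_edges C))"
proof -
  obtain F where F: "F \<in> faces V E \<gamma>" "\<not> bounded F" "face_edges F = cycle_edges C"
    using outer_face by metis
  \<comment> \<open>The outer face is the whole outside of \<open>C\<close>, and a face contains no
    point of the drawing.\<close>
  have "F = outside (drawn_edges \<gamma> (cycle_edges C))"
    using face_eq_side[OF F(1)] F(2) frontier_face[OF F(1)] F(3) by simp
  then show ?thesis
    using face_props(4)[OF F(1)] inside_Un_outside[of "drawn_edges \<gamma> (cycle_edges C)"] by blast
qed

text \<open>If the paths were disjoint, \<open>p\<close> would cut the disc into two regions, one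
  bounded by \<open>p\<close> and v1 v2 v3, the other by \<open>p\<close> and v1 v4 v3. The path
  \<open>q\<close> without its ends is connected and would stay in one region, but \<open>v4\<close>
  is not in the closure of the first and \<open>v2\<close> is not in the closure of the
  second.\<close>

lemma crossing_paths_meet:
  assumes C: "C = [v1, v2, v3, v4]"
    and p: "p \<in> paths V E v1 v3" and q: "q \<in> paths V E v2 v4"
  shows "set p \<inter> set q \<noteq> {}"
proof
  assume disj: "set p \<inter> set q = {}"
  have dist: "distinct [v1, v2, v3, v4]"
    and CE: "{{v1, v2}, {v2, v3}, {v3, v4}, {v4, v1}} \<subseteq> E"
    using cycle_C unfolding C is_cycle_def cycle_edges_4 by auto
  have p': "distinct p" "p \<noteq> []" "hd p = v1" "last p = v3" "path_edges p \<subseteq> E"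
    and q': "distinct q" "q \<noteq> []" "hd q = v2" "last q = v4" "path_edges q \<subseteq> E"
    using p q unfolding paths_def successively_path_edges by auto
  have ends: "v1 \<in> set p" "v3 \<in> set p" "v2 \<in> set q" "v4 \<in> set q"
    using p'(2-4) q'(2-4) hd_in_set[of p] last_in_set[of p] hd_in_set[of q] last_in_set[of q] by simp_all
  \<comment> \<open>Hence each of the two drawn paths meets the outer cycle in its own ends
    only.\<close>
  have off: "v2 \<notin> set p" "v4 \<notin> set p" "v1 \<notin> set q" "v3 \<notin> set q" using ends disj by auto
  have len: "2 \<le> length p" "2 \<le> length q"
    using p'(2-4) q'(2-4) dist by (cases p; cases q; auto simp: Suc_le_eq split: if_splits)+
  let ?r1 = "[v1, v2, v3]" and ?r2 = "[v1, v4, v3]"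
  have r: "path_edges ?r1 = {{v1, v2}, {v2, v3}}" "path_edges ?r2 = {{v1, v4}, {v4, v3}}" by auto
  have rE: "path_edges ?r1 \<subseteq> E" "path_edges ?r2 \<subseteq> E"
    using CE unfolding r by (simp_all add: insert_commute)
  have r1: "distinct ?r1" "2 \<le> length ?r1" "hd ?r1 = v1" "last ?r1 = v3"
    and r2: "distinct ?r2" "2 \<le> length ?r2" "hd ?r2 = v1" "last ?r2 = v3"
    using dist by auto
  obtain c1 where c1: "arc c1" "pathstart c1 = v1" "pathfinish c1 = v3"
    "path_image c1 = drawn_edges \<gamma> (path_edges ?r1)"
    using drawn_path_arc[OF r1(1,2) rE(1)] unfolding r1(3,4) .
  obtain c2 where c2: "arc c2" "pathstart c2 = v1" "pathfinish c2 = v3"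
    "path_image c2 = drawn_edges \<gamma> (path_edges ?r2)"
    using drawn_path_arc[OF r2(1,2) rE(2)] unfolding r2(3,4) .
  obtain c where c: "arc c" "pathstart c = v1" "pathfinish c = v3"
    "path_image c = drawn_edges \<gamma> (path_edges p)"
    using drawn_path_arc[OF p'(1) len(1) p'(5)] unfolding p'(3,4) .
  obtain d where d: "arc d" "pathstart d = v2" "pathfinish d = v4"
    "path_image d = drawn_edges \<gamma> (path_edges q)"
    using drawn_path_arc[OF q'(1) len(2) q'(5)] unfolding q'(3,4) .
  have e_disj: "path_edges ?r1 \<inter> path_edges ?r2 = {}"
    using dist unfolding r by (auto simp: doubleton_eq_iff)
  have e_off: "path_edges s \<inter> A = {}" if "\<forall>e\<in>A. \<not> e \<subseteq> set s" for A and s :: "complex list"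
    using path_edges_subset[of _ s] that by blast
  have c12: "path_image c1 \<inter> path_image c2 = {v1, v3}"
    unfolding c1(4) c2(4) using dist by (subst drawn_paths_Int[OF rE e_disj]) auto
  have cc: "path_image c1 \<inter> path_image c = {v1, v3}" "path_image c2 \<inter> path_image c = {v1, v3}"
  proof -
    have "path_edges ?r1 \<inter> path_edges p = {}" "path_edges ?r2 \<inter> path_edges p = {}"
      using e_off[of _ p] off unfolding r by (subst Int_commute, simp)+
    then show "path_image c1 \<inter> path_image c = {v1, v3}" "path_image c2 \<inter> path_image c = {v1, v3}"
      unfolding c1(4) c2(4) c(4) using ends off len rE p'(5)
      by (subst drawn_paths_Int; auto)+
  qed
  have dd: "path_image c1 \<inter> path_image d = {v2}" "path_image c2 \<inter> path_image d = {v4}"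
  proof -
    have "path_edges ?r1 \<inter> path_edges q = {}" "path_edges ?r2 \<inter> path_edges q = {}"
      using e_off[of _ q] off unfolding r by (subst Int_commute, simp)+
    then show "path_image c1 \<inter> path_image d = {v2}" "path_image c2 \<inter> path_image d = {v4}"
      unfolding c1(4) c2(4) d(4) using ends off len rE q'(5)
      by (subst drawn_paths_Int; auto)+
  qed
  have cd: "path_image c \<inter> path_image d = {}"
  proof -
    have "path_edges p \<inter> path_edges q = {}"
    proof (rule e_off, rule ballI, rule notI)
      fix e assume e: "e \<in> path_edges q" "e \<subseteq> set p"
      then have "e = {}" using path_edges_subset[of e q] disj by blast
      then show False using e(1) by (auto simp: path_edges_def)
    qed
    then show ?thesis
      unfolding c(4) d(4) using drawn_paths_Int[OF p'(5) q'(5) _ len] disj by simp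
  qed
  define J where "J = path_image c1 \<union> path_image c2"
  have J: "drawn_edges \<gamma> (cycle_edges C) = J"
    unfolding J_def c1(4) c2(4) r C cycle_edges_4 by (auto simp: insert_commute drawn_edges_def)
  have disc: "drawing \<subseteq> J \<union> inside J" using drawing_subset_closed_disc unfolding J .
  have c_disc: "path_image c \<subseteq> J \<union> inside J" and d_disc: "path_image d \<subseteq> J \<union> inside J"
    using disc p'(5) q'(5) unfolding c(4) d(4) drawn_edges_def by blast+
  \<comment> \<open>An inner point of \<open>c\<close> is in the closed disc but on neither boundary
    arc, so \<open>c\<close> runs through the inside.\<close>
  have "path_image c - {v1, v3} \<noteq> {}"
    using nonempty_simple_path_endless[OF arc_imp_simple_path[OF c(1)]] c(2,3) by simp
  then have meets: "path_image c \<inter> inside (path_image c1 \<union> path_image c2) \<noteq> {}"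
    using c_disc cc unfolding J_def by blast
  define I1 where "I1 = inside (path_image c1 \<union> path_image c)"
  define I2 where "I2 = inside (path_image c2 \<union> path_image c)"
  have "v1 \<noteq> v3" using dist by simp
  \<comment> \<open>The arcs \<open>c1\<close>, \<open>c2\<close> and \<open>c\<close> form a theta
    curve: three arcs from \<open>v1\<close> to \<open>v3\<close> that are otherwise
    disjoint.\<close>
  note split = split_inside_simple_closed_curve[OF arc_imp_simple_path[OF c1(1)] c1(2,3)
      arc_imp_simple_path[OF c2(1)] c2(2,3) arc_imp_simple_path[OF c(1)] c(2,3) this c12 cc meets]
  have I: "I1 \<inter> I2 = {}" "I1 \<union> I2 \<union> (path_image c - {v1, v3}) = inside J"
    unfolding I1_def I2_def J_def
    by (rule split; assumption)+
  have cl: "closed (path_image c1 \<union> path_image c)" "closed (path_image c2 \<union> path_image c)"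
    using c1(1) c2(1) c(1) by (simp_all add: closed_Un closed_arc_image)
  define D where "D = path_image d - {v2, v4}"
  have D: "D = d ` {0<..<1}"
    using simple_path_endless[OF arc_imp_simple_path[OF d(1)]] d(2,3) by (simp add: D_def)
  have "connected D"
    using connected_simple_path_endless[OF arc_imp_simple_path[OF d(1)]] d(2,3) by (simp add: D_def)
  moreover have "D \<subseteq> I1 \<union> I2"
  proof
    fix x assume x: "x \<in> D"
    then have "x \<notin> J" "x \<notin> path_image c" using dd cd unfolding D_def J_def by blast+
    then show "x \<in> I1 \<union> I2" using x d_disc I(2) unfolding D_def by blast
  qed
  moreover have "open I1" "open I2" using cl open_inside unfolding I1_def I2_def by blast+
  ultimately have "D \<subseteq> I1 \<or> D \<subseteq> I2"
    using connectedD[of D I1 I2] I(1) by blast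
  \<comment> \<open>By continuity of \<open>d\<close> on the closed interval, both ends of
    \<open>d\<close> are limits of points of \<open>D\<close>.\<close>
  moreover have closure: "{v2, v4} \<subseteq> closure U" if "D \<subseteq> U" for U
  proof -
    have "d ` closure {0<..<1} \<subseteq> closure U"
    proof (rule image_closure_subset)
      show "continuous_on (closure {0<..<1}) d"
        using arc_imp_path[OF d(1)] by (simp add: path_def)
      show "d ` {0<..<1} \<subseteq> closure U" using that closure_subset D by blast
    qed simp
    then have "d 0 \<in> closure U" "d 1 \<in> closure U" by (auto simp: image_subset_iff)
    then show ?thesis using d(2,3) by (simp add: pathstart_def pathfinish_def)
  qed
  \<comment> \<open>The closure adds at most \<open>c1\<close> and \<open>c\<close> to
    \<open>I1\<close>. The vertex \<open>v4\<close> is on neither, and as a point of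
    \<open>J\<close> it is not inside \<open>J\<close>.\<close>
  moreover have "v4 \<notin> closure I1"
  proof
    assume "v4 \<in> closure I1"
    then have "v4 \<in> path_image c1 \<union> path_image c \<union> I1"
      using closure_inside_subset[OF cl(1)] unfolding I1_def by blast
    moreover have "v4 \<in> path_image c2" using dd by blast
    then have "v4 \<notin> inside J" using inside_no_overlap[of J] unfolding J_def by blast
    then have "v4 \<notin> I1" using I(2) by blast
    ultimately have "v4 \<in> path_image c1 \<or> v4 \<in> path_image c" by blast
    then show False using \<open>v4 \<in> path_image c2\<close> c12 cc dist by auto
  qed
  moreover have "v2 \<notin> closure I2"
  proof
    assume "v2 \<in> closure I2"
    then have "v2 \<in> path_image c2 \<union> path_image c \<union> I2"
      using closure_inside_subset[OF cl(2)] unfolding I2_def by blast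
    moreover have "v2 \<in> path_image c1" using dd by blast
    then have "v2 \<notin> inside J" using inside_no_overlap[of J] unfolding J_def by blast
    then have "v2 \<notin> I2" using I(2) by blast
    ultimately have "v2 \<in> path_image c2 \<or> v2 \<in> path_image c" by blast
    then show False using \<open>v2 \<in> path_image c1\<close> c12 cc dist by auto
  qed
  ultimately show False by blast
qed

section \<open>Parity of two-coloured components on triangles\<close>

lemma bounded_face_triangle:
  assumes "F \<in> faces V E \<gamma>" "bounded F"
  obtains a b c where "distinct [a, b, c]" "face_edges F = {{a, b}, {b, c}, {c, a}}"
proof -
  obtain T where T: "is_cycle V E T" "length T = 3" "face_bounded_by \<gamma> F T"
    using assms smpg unfolding semi_maximal_planar_graph_def by blast
  from T(2) obtain a b c where abc: "T = [a, b, c]" by (auto simp: numeral_3_eq_3 length_Suc_conv)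
  have "distinct [a, b, c]" using T(1) unfolding abc is_cycle_def by blast
  moreover have "face_edges F = {{a, b}, {b, c}, {c, a}}"
    using face_edges_eq[OF T(1,3)] unfolding abc cycle_edges_3 .
  ultimately show thesis by (rule that)
qed

text \<open>The parity of the edges between the component \<open>X\<close> of \<open>v1\<close> in
  colours \<open>i\<close>, \<open>j\<close> and the component \<open>Y\<close> of \<open>v2\<close>
  in colours \<open>k\<close>, \<open>l\<close> is transported from the triangles to
  \<open>C\<close>. The colours are left general so that both pairings of the four colours are
  covered.\<close>

lemma bicoloured_path_exists:
  assumes C: "C = [v1, v2, v3, v4]"
    and f: "f ` V \<subseteq> {i, j, k, l}" "{i, j} \<inter> {k, l} = {}"
    and fv: "f v1 \<in> {i, j}" "f v3 \<in> {i, j}" "f v2 \<in> {k, l}" "f v4 \<in> {k, l}"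
  shows "bicoloured_paths V E f i j v1 v3 \<noteq> {} \<or> bicoloured_paths V E f k l v2 v4 \<noteq> {}"
proof -
  have vV: "v1 \<in> V" "v2 \<in> V" "v3 \<in> V" "v4 \<in> V"
    and CE: "{{v1, v2}, {v2, v3}, {v3, v4}, {v4, v1}} \<subseteq> E"
    using cycle_C unfolding C is_cycle_def cycle_edges_4 by auto
  define X where "X = {w. bicoloured_paths V E f i j v1 w \<noteq> {}}"
  define Y where "Y = {w. bicoloured_paths V E f k l v2 w \<noteq> {}}"
  define M where "M = {e \<in> E. \<exists>a\<in>X. \<exists>b\<in>Y. e = {a, b}}"
  have X: "f w \<in> {i, j}" if "w \<in> X" for w
    using bicoloured_paths_end[of V E f i j v1 w] that unfolding X_def by blast
  have Y: "f w \<notin> {i, j}" if "w \<in> Y" for w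
    using bicoloured_paths_end[of V E f k l v2 w] that f(2) unfolding Y_def by blast
  have Xstep: "b \<in> X" if "{a, b} \<in> E" "a \<in> X" "f b \<in> {i, j}" for a b
    using bicoloured_paths_extend[of V E f i j v1 a b] that edge_subset_V[OF that(1)]
    unfolding X_def by simp
  have Ystep: "b \<in> Y" if "{a, b} \<in> E" "a \<in> Y" "f b \<notin> {i, j}" for a b
  proof -
    have "b \<in> V" using edge_subset_V[OF that(1)] by blast
    then have "f b \<in> {k, l}" using f(1) that(3) by blast
    then show ?thesis
      using bicoloured_paths_extend[of V E f k l v2 a b] that \<open>b \<in> V\<close> unfolding Y_def by simp
  qed
  have M: "{a, b} \<in> M \<longleftrightarrow> a \<in> X \<and> b \<in> Y \<or> b \<in> X \<and> a \<in> Y" if "{a, b} \<in> E" for a b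
    using that unfolding M_def by (auto simp: doubleton_eq_iff)
  have v1X: "v1 \<in> X" and v2Y: "v2 \<in> Y"
    using bicoloured_paths_refl[of v1 V f i j E] bicoloured_paths_refl[of v2 V f k l E] vV fv
    unfolding X_def Y_def by simp_all
  have "even (card (M \<inter> cycle_edges C))"
  proof (rule even_card_boundary_edges)
    show "M \<subseteq> E" by (auto simp: M_def)
    fix F assume F: "F \<in> faces V E \<gamma>" "bounded F"
    obtain a b c where abc: "distinct [a, b, c]" "face_edges F = {{a, b}, {b, c}, {c, a}}"
      using bounded_face_triangle[OF F] .
    then have E: "{a, b} \<in> E" "{b, c} \<in> E" "{c, a} \<in> E" by (auto simp: face_edges_def)
    then have E': "{b, a} \<in> E" "{c, b} \<in> E" "{a, c} \<in> E" by (simp_all add: insert_commute)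
    have card: "card (M \<inter> face_edges F) = of_bool ({a, b} \<in> M) + of_bool ({b, c} \<in> M) + of_bool ({c, a} \<in> M)"
      using abc(1) unfolding abc(2) by (auto simp: Int_insert_right doubleton_eq_iff)
    have even3: "even (of_bool p + of_bool q + of_bool r :: nat) \<longleftrightarrow> ((p \<longleftrightarrow> q) \<longleftrightarrow> \<not> r)" for p q r
      by (cases p; cases q; cases r; simp)
    \<comment> \<open>Adjacent vertices from the same pair of colours are both in the component or
      both outside. If a triangle has two vertices in one pair and the third in the other, the two
      edges at the third vertex are therefore both in \<open>M\<close> or both not, and the
      remaining edge is not in \<open>M\<close>. With all three in one pair, no edge is in
      \<open>M\<close>.\<close>
    have "a \<in> X \<longleftrightarrow> b \<in> X" if "f a \<in> {i, j}" "f b \<in> {i, j}"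
      using Xstep[OF E(1)] Xstep[OF E'(1)] that by blast
    moreover have "b \<in> X \<longleftrightarrow> c \<in> X" if "f b \<in> {i, j}" "f c \<in> {i, j}"
      using Xstep[OF E(2)] Xstep[OF E'(2)] that by blast
    moreover have "c \<in> X \<longleftrightarrow> a \<in> X" if "f c \<in> {i, j}" "f a \<in> {i, j}"
      using Xstep[OF E(3)] Xstep[OF E'(3)] that by blast
    moreover have "a \<in> Y \<longleftrightarrow> b \<in> Y" if "f a \<notin> {i, j}" "f b \<notin> {i, j}"
      using Ystep[OF E(1)] Ystep[OF E'(1)] that by blast
    moreover have "b \<in> Y \<longleftrightarrow> c \<in> Y" if "f b \<notin> {i, j}" "f c \<notin> {i, j}"
      using Ystep[OF E(2)] Ystep[OF E'(2)] that by blast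
    moreover have "c \<in> Y \<longleftrightarrow> a \<in> Y" if "f c \<notin> {i, j}" "f a \<notin> {i, j}"
      using Ystep[OF E(3)] Ystep[OF E'(3)] that by blast
    ultimately show "even (card (M \<inter> face_edges F))"
      using X[of a] X[of b] X[of c] Y[of a] Y[of b] Y[of c]
      unfolding card even3 M[OF E(1)] M[OF E(2)] M[OF E(3)] by (smt (verit))
  qed
  moreover have "{v1, v2} \<in> M" using M[of v1 v2] v1X v2Y CE by simp
  \<comment> \<open>A single edge would be an odd number, so a second edge of \<open>C\<close>
    belongs to \<open>M\<close>.\<close>
  ultimately have "M \<inter> cycle_edges C \<noteq> {{v1, v2}}" by auto
  then have "{v2, v3} \<in> M \<or> {v3, v4} \<in> M \<or> {v4, v1} \<in> M"
    using \<open>{v1, v2} \<in> M\<close> unfolding C cycle_edges_4 by blast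
  then have "v3 \<in> X \<or> v4 \<in> Y"
  proof -
    have "{v2, v3} \<in> E" "{v3, v4} \<in> E" "{v4, v1} \<in> E" using CE by simp_all
    \<comment> \<open>The colours leave one orientation for each edge: \<open>{v2, v3}\<close> puts
      \<open>v3\<close> in \<open>X\<close>, \<open>{v4, v1}\<close> puts \<open>v4\<close> in
      \<open>Y\<close>, and \<open>{v3, v4}\<close> does both.\<close>
    moreover have "v2 \<notin> X" "v4 \<notin> X" using X fv(3,4) f(2) by blast+
    moreover have "v1 \<notin> Y" using Y fv(1) by blast
    ultimately show ?thesis
      using \<open>{v2, v3} \<in> M \<or> {v3, v4} \<in> M \<or> {v4, v1} \<in> M\<close> by (auto simp: M)
  qed
  then show ?thesis unfolding X_def Y_def by blast
qed

text \<open>Paths in disjoint pairs of colours share no vertex, so two of them would contradict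
  \<open>crossing_paths_meet\<close>; the parity argument supplies at least one.\<close>

lemma bicoloured_path_exactly_one:
  assumes C: "C = [v1, v2, v3, v4]"
    and f: "f ` V \<subseteq> {i, j, k, l}" "{i, j} \<inter> {k, l} = {}"
    and fv: "f v1 \<in> {i, j}" "f v3 \<in> {i, j}" "f v2 \<in> {k, l}" "f v4 \<in> {k, l}"
  shows "bicoloured_paths V E f i j v1 v3 \<noteq> {} \<longleftrightarrow> bicoloured_paths V E f k l v2 v4 = {}"
proof -
  have False if p: "p \<in> bicoloured_paths V E f i j v1 v3" and q: "q \<in> bicoloured_paths V E f k l v2 v4" for p q
  proof -
    have "set p \<inter> set q = {}" using p q f(2) unfolding bicoloured_paths_def by blast
    then show False using crossing_paths_meet[OF C, of p q] p q unfolding bicoloured_paths_def by blast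
  qed
  then show ?thesis using bicoloured_path_exists[OF assms] by blast
qed

end

theorem theorem2:
  fixes V :: "complex set" and E :: "complex set set"
    and \<gamma> :: "complex set \<Rightarrow> real \<Rightarrow> complex" and v1 v2 v3 v4 :: complex
  assumes "semi_maximal_planar_graph V E \<gamma> [v1, v2, v3, v4]"
    and "chromatic_number V E = 4"
    and "F2 V E {v1, v2, v3, v4} \<noteq> {}"
  shows "\<forall>c \<in> F2 V E {v1, v2, v3, v4}. \<forall>f \<in> c.
           f v1 = 1 \<and> f v3 = 1 \<and> f v2 = 2 \<and> f v4 = 2 \<longrightarrow>
           length (filter (\<lambda>P. P \<noteq> {})
             [bicoloured_paths V E f 1 3 v1 v3, bicoloured_paths V E f 1 4 v1 v3,
              bicoloured_paths V E f 2 3 v2 v4, bicoloured_paths V E f 2 4 v2 v4]) = 2"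
proof (intro ballI impI)
  fix c f assume c: "c \<in> F2 V E {v1, v2, v3, v4}" and f: "f \<in> c"
    and fv: "f v1 = 1 \<and> f v3 = 1 \<and> f v2 = 2 \<and> f v4 = 2"
  interpret smpg V E \<gamma> "[v1, v2, v3, v4]"
    by unfold_locales (use assms(1) in \<open>simp_all add: semi_maximal_planar_graph_def\<close>)
  have "f \<in> colourings V E 4"
    using c f in_quotient_imp_subset[OF equiv_colour_renaming] unfolding F2_def C40_def by blast
  then have "f ` V \<subseteq> {1..4}" by (auto simp: colourings_def)
  \<comment> \<open>The two orders of the colours match the complementary pairings 1, 3 against 2, 4
    and 1, 4 against 2, 3.\<close>
  moreover have "{1..4} = {1, 3, 2, 4::nat}" "{1..4} = {1, 4, 2, 3::nat}" by auto
  ultimately have fV: "f ` V \<subseteq> {1, 3, 2, 4}" "f ` V \<subseteq> {1, 4, 2, 3}" by simp_all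
  have "bicoloured_paths V E f 1 3 v1 v3 \<noteq> {} \<longleftrightarrow> bicoloured_paths V E f 2 4 v2 v4 = {}"
    using fv by (intro bicoloured_path_exactly_one[OF refl fV(1)]) simp_all
  moreover have "bicoloured_paths V E f 1 4 v1 v3 \<noteq> {} \<longleftrightarrow> bicoloured_paths V E f 2 3 v2 v4 = {}"
    using fv by (intro bicoloured_path_exactly_one[OF refl fV(2)]) simp_all
  \<comment> \<open>Each pairing contributes exactly one nonempty set, which makes two in
    all.\<close>
  ultimately show "length (filter (\<lambda>P. P \<noteq> {})
      [bicoloured_paths V E f 1 3 v1 v3, bicoloured_paths V E f 1 4 v1 v3,
       bicoloured_paths V E f 2 3 v2 v4, bicoloured_paths V E f 2 4 v2 v4]) = 2"
    by auto
qed

end
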